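(* Let $\mathbb{C}$ be a finitely complete, locally small category that has tensors with sets (i.e. for every set $\lambda$ and every object $X\in\mathbb{C}$ the coproduct $\coprod_\lambda X$ of $\lambda$ copies of $X$ exists), and let $\mathbf{cat}(\mathbb{C})$ be the 2-category of categories internal to $\mathbb{C}$. If a $\mathbb{C}$-internal category $A\in\mathbf{cat}(\mathbb{C})$ has simple ad hoc polymorphism, then $A$ is an internal poset.
   Context: $\mathbf{cat}(\mathbb{C})$ has internal categories, internal functors and internal natural transformations. Objects of $\mathbb{C}$ are regarded as discrete internal categories. For a set $\lambda$ and $X\in\mathbb{C}$, write $\lambda\otimes X$ for the tensor in $\mathbf{cat}(\mathbb{C})$, i.e. the object with a 2-natural isomorphism $\hom_{\mathbf{Cat}}(\lambda,\hom(X,-))\cong\hom(\lambda\otimes X,-)$, with $\lambda$ regarded as a discrete category; it is the discrete internal category on $\coprod_\lambda X$. A function $s\colon\lambda'\to\lambda$ induces $s\otimes X\colon\lambda'\otimes X\to\lambda\otimes X$. $A$ has simple ad hoc polymorphism if it has all ad hoc simple products parametrised by discrete objects: for every $X\in\mathbb{C}$, all sets $\lambda,\lambda'$, and every internal functor $\tau\colon(\lambda\times\lambda')\otimes X\to A$, the right Kan extension of $\tau$ along $p\otimes X\colon(\lambda\times\lambda')\otimes X\to\lambda\otimes X$ exists in $\mathbf{cat}(\mathbb{C})$, where $p\colon\lambda\times\lambda'\to\lambda$ is the projection. Here the right Kan extension of $\tau\colon Z\to A$ along $s\colon Z\to Y$ is a morphism $\prod_s\tau\colon Y\to A$ with bijections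 $\hom(h,\prod_s\tau)\cong\hom(h\circ s,\tau)$ natural in $h\colon Y\to A$. An internal poset is an internal category $A$ for which $\langle\mathit{dom},\mathit{cod}\rangle\colon A_1\to A_0\times A_0$ is a monomorphism. *)

theory Defs
  imports Main
begin

unbundle cardinal_syntax

text \<open>
  Size is measured by a fixed cardinal \<open>\<kappa>\<close>, given as a cardinal order on a type \<open>'i\<close>:
  a HOL set of any type is \<open>\<kappa>\<close>-small if it has fewer than \<open>\<kappa>\<close> elements.  For \<open>\<kappa>\<close> infinite,
  regular and a strong limit, the \<open>\<kappa>\<close>-small sets are, up to bijection, the members of a
  Grothendieck universe (\<open>\<kappa> = \<omega>\<close> is allowed), and each of them is equipotent to a
  \<open>\<kappa>\<close>-small set of elements of \<open>'i\<close>.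
\<close>

definition universe_cardinal :: "'i rel \<Rightarrow> bool" where
  "universe_cardinal \<kappa> \<longleftrightarrow>
     Card_order \<kappa> \<and> infinite (Field \<kappa>) \<and> regularCard \<kappa> \<and>
     (\<forall>S :: 'i set. |S| <o \<kappa> \<longrightarrow> |Pow S| <o \<kappa>)"

definition small :: "'i rel \<Rightarrow> 'a set \<Rightarrow> bool" where
  "small \<kappa> S \<longleftrightarrow> |S| <o \<kappa>"


record ('o, 'm) cat =
  Obj :: "'o set"
  Arr :: "'m set"
  Dom :: "'m \<Rightarrow> 'o"
  Cod :: "'m \<Rightarrow> 'o"
  Ident :: "'o \<Rightarrow> 'm"
  Comp :: "'m \<Rightarrow> 'm \<Rightarrow> 'm"  (infixl "\<cdot>\<index>" 70)

definition hom :: "('o, 'm) cat \<Rightarrow> 'o \<Rightarrow> 'o \<Rightarrow> 'm set" where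
  "hom C X Y = {f \<in> Arr C. Dom C f = X \<and> Cod C f = Y}"

locale category =
  fixes C :: "('o, 'm) cat"  (structure)
  assumes Dom_Obj: "f \<in> Arr C \<Longrightarrow> Dom C f \<in> Obj C"
    and Cod_Obj: "f \<in> Arr C \<Longrightarrow> Cod C f \<in> Obj C"
    and Ident_hom: "X \<in> Obj C \<Longrightarrow> Ident C X \<in> hom C X X"
    and Comp_hom: "\<lbrakk>f \<in> hom C X Y; g \<in> hom C Y Z\<rbrakk> \<Longrightarrow> g \<cdot> f \<in> hom C X Z"
    and Ident_left: "f \<in> hom C X Y \<Longrightarrow> Ident C Y \<cdot> f = f"
    and Ident_right: "f \<in> hom C X Y \<Longrightarrow> f \<cdot> Ident C X = f"
    and Comp_assoc: "\<lbrakk>f \<in> hom C W X; g \<in> hom C X Y; h \<in> hom C Y Z\<rbrakk> \<Longrightarrow>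
           h \<cdot> (g \<cdot> f) = (h \<cdot> g) \<cdot> f"

definition locally_small :: "'i rel \<Rightarrow> ('o, 'm) cat \<Rightarrow> bool" where
  "locally_small \<kappa> C \<longleftrightarrow> (\<forall>X \<in> Obj C. \<forall>Y \<in> Obj C. small \<kappa> (hom C X Y))"

definition monomorphism :: "('o, 'm) cat \<Rightarrow> 'm \<Rightarrow> bool" where
  "monomorphism C m \<longleftrightarrow> m \<in> Arr C \<and>
     (\<forall>W \<in> Obj C. \<forall>f \<in> hom C W (Dom C m). \<forall>g \<in> hom C W (Dom C m).
        m \<cdot>\<^bsub>C\<^esub> f = m \<cdot>\<^bsub>C\<^esub> g \<longrightarrow> f = g)"


definition is_functor ::
  "('a, 'b) cat \<Rightarrow> ('o, 'm) cat \<Rightarrow> ('a \<Rightarrow> 'o) \<Rightarrow> ('b \<Rightarrow> 'm) \<Rightarrow> bool" where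
  "is_functor J C D0 D1 \<longleftrightarrow>
     (\<forall>j \<in> Obj J. D0 j \<in> Obj C) \<and>
     (\<forall>u \<in> Arr J. D1 u \<in> hom C (D0 (Dom J u)) (D0 (Cod J u))) \<and>
     (\<forall>j \<in> Obj J. D1 (Ident J j) = Ident C (D0 j)) \<and>
     (\<forall>u \<in> Arr J. \<forall>v \<in> Arr J. Cod J u = Dom J v \<longrightarrow>
        D1 (v \<cdot>\<^bsub>J\<^esub> u) = D1 v \<cdot>\<^bsub>C\<^esub> D1 u)"

definition is_cone ::
  "('a, 'b) cat \<Rightarrow> ('o, 'm) cat \<Rightarrow> ('a \<Rightarrow> 'o) \<Rightarrow> ('b \<Rightarrow> 'm) \<Rightarrow> 'o \<Rightarrow> ('a \<Rightarrow> 'm) \<Rightarrow> bool" where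
  "is_cone J C D0 D1 L \<pi> \<longleftrightarrow>
     L \<in> Obj C \<and> (\<forall>j \<in> Obj J. \<pi> j \<in> hom C L (D0 j)) \<and>
     (\<forall>u \<in> Arr J. D1 u \<cdot>\<^bsub>C\<^esub> \<pi> (Dom J u) = \<pi> (Cod J u))"

definition is_limit ::
  "('a, 'b) cat \<Rightarrow> ('o, 'm) cat \<Rightarrow> ('a \<Rightarrow> 'o) \<Rightarrow> ('b \<Rightarrow> 'm) \<Rightarrow> 'o \<Rightarrow> ('a \<Rightarrow> 'm) \<Rightarrow> bool" where
  "is_limit J C D0 D1 L \<pi> \<longleftrightarrow>
     is_cone J C D0 D1 L \<pi> \<and>
     (\<forall>W \<rho>. is_cone J C D0 D1 W \<rho> \<longrightarrow>
        (\<exists>!u. u \<in> hom C W L \<and> (\<forall>j \<in> Obj J. \<pi> j \<cdot>\<^bsub>C\<^esub> u = \<rho> j)))"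

text \<open>Every finite category is isomorphic to one whose objects and arrows are natural numbers.\<close>

definition finitely_complete :: "('o, 'm) cat \<Rightarrow> bool" where
  "finitely_complete C \<longleftrightarrow>
     (\<forall>(J :: (nat, nat) cat) D0 D1.
        category J \<and> finite (Obj J) \<and> finite (Arr J) \<and> is_functor J C D0 D1 \<longrightarrow>
        (\<exists>L \<pi>. is_limit J C D0 D1 L \<pi>))"

definition is_product :: "('o, 'm) cat \<Rightarrow> 'o \<Rightarrow> 'o \<Rightarrow> 'o \<Rightarrow> 'm \<Rightarrow> 'm \<Rightarrow> bool" where
  "is_product C X Y P \<pi>1 \<pi>2 \<longleftrightarrow>
     P \<in> Obj C \<and> \<pi>1 \<in> hom C P X \<and> \<pi>2 \<in> hom C P Y \<and>
     (\<forall>W \<in> Obj C. \<forall>f \<in> hom C W X. \<forall>g \<in> hom C W Y.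
        \<exists>!u. u \<in> hom C W P \<and> \<pi>1 \<cdot>\<^bsub>C\<^esub> u = f \<and> \<pi>2 \<cdot>\<^bsub>C\<^esub> u = g)"

definition is_pullback :: "('o, 'm) cat \<Rightarrow> 'm \<Rightarrow> 'm \<Rightarrow> 'o \<Rightarrow> 'm \<Rightarrow> 'm \<Rightarrow> bool" where
  "is_pullback C a b P p q \<longleftrightarrow>
     a \<in> Arr C \<and> b \<in> Arr C \<and> Cod C a = Cod C b \<and>
     P \<in> Obj C \<and> p \<in> hom C P (Dom C a) \<and> q \<in> hom C P (Dom C b) \<and> a \<cdot>\<^bsub>C\<^esub> p = b \<cdot>\<^bsub>C\<^esub> q \<and>
     (\<forall>W \<in> Obj C. \<forall>f \<in> hom C W (Dom C a). \<forall>g \<in> hom C W (Dom C b).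
        a \<cdot>\<^bsub>C\<^esub> f = b \<cdot>\<^bsub>C\<^esub> g \<longrightarrow>
        (\<exists>!u. u \<in> hom C W P \<and> p \<cdot>\<^bsub>C\<^esub> u = f \<and> q \<cdot>\<^bsub>C\<^esub> u = g))"

definition is_copower :: "('o, 'm) cat \<Rightarrow> 'k set \<Rightarrow> 'o \<Rightarrow> 'o \<Rightarrow> ('k \<Rightarrow> 'm) \<Rightarrow> bool" where
  "is_copower C I X P \<iota> \<longleftrightarrow>
     X \<in> Obj C \<and> P \<in> Obj C \<and> (\<forall>k \<in> I. \<iota> k \<in> hom C X P) \<and>
     (\<forall>W \<in> Obj C. \<forall>f. (\<forall>k \<in> I. f k \<in> hom C X W) \<longrightarrow>
        (\<exists>!u. u \<in> hom C P W \<and> (\<forall>k \<in> I. u \<cdot>\<^bsub>C\<^esub> \<iota> k = f k)))"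

definition has_tensors :: "'i rel \<Rightarrow> ('o, 'm) cat \<Rightarrow> bool" where
  "has_tensors \<kappa> C \<longleftrightarrow>
     (\<forall>I :: 'i set. small \<kappa> I \<longrightarrow> (\<forall>X \<in> Obj C. \<exists>P \<iota>. is_copower C I X P \<iota>))"

text \<open>
  The arrow between copowers of \<open>X\<close> induced by \<open>s : I \<rightarrow> I'\<close>; it is unique if \<open>(P, \<iota>)\<close> is a
  copower.
\<close>

definition is_copower_map ::
  "('o, 'm) cat \<Rightarrow> 'k set \<Rightarrow> ('k \<Rightarrow> 'l) \<Rightarrow> 'o \<Rightarrow> ('k \<Rightarrow> 'm) \<Rightarrow> 'o \<Rightarrow> ('l \<Rightarrow> 'm) \<Rightarrow> 'm \<Rightarrow> bool" where
  "is_copower_map C I s P \<iota> P' \<iota>' u \<longleftrightarrow>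
     u \<in> hom C P P' \<and> (\<forall>k \<in> I. u \<cdot>\<^bsub>C\<^esub> \<iota> k = \<iota>' (s k))"


text \<open>
  \<open>A2\<close> is a pullback of \<open>dom\<close> and \<open>cod\<close>; on generalized elements it consists of the pairs
  \<open>(g, f)\<close> with \<open>dom g = cod f\<close>, with projections \<open>pr1\<close> to \<open>g\<close> and \<open>pr2\<close> to \<open>f\<close>,
  and \<open>cmp\<close> sends \<open>(g, f)\<close> to \<open>g \<circ> f\<close>.
\<close>

record ('o, 'm) icat =
  A0 :: 'o
  A1 :: 'o
  A2 :: 'o
  dom :: 'm
  cod :: 'm
  idn :: 'm
  pr1 :: 'm
  pr2 :: 'm
  cmp :: 'm

definition ipair :: "('o, 'm) cat \<Rightarrow> ('o, 'm) icat \<Rightarrow> 'm \<Rightarrow> 'm \<Rightarrow> 'm" where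
  "ipair C A g f =
     (THE u. u \<in> hom C (Dom C g) (A2 A) \<and> pr1 A \<cdot>\<^bsub>C\<^esub> u = g \<and> pr2 A \<cdot>\<^bsub>C\<^esub> u = f)"

definition icomp :: "('o, 'm) cat \<Rightarrow> ('o, 'm) icat \<Rightarrow> 'm \<Rightarrow> 'm \<Rightarrow> 'm" where
  "icomp C A g f = cmp A \<cdot>\<^bsub>C\<^esub> ipair C A g f"

definition internal_category :: "('o, 'm) cat \<Rightarrow> ('o, 'm) icat \<Rightarrow> bool" where
  "internal_category C A \<longleftrightarrow>
     A0 A \<in> Obj C \<and> A1 A \<in> Obj C \<and>
     dom A \<in> hom C (A1 A) (A0 A) \<and> cod A \<in> hom C (A1 A) (A0 A) \<and>
     idn A \<in> hom C (A0 A) (A1 A) \<and>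
     is_pullback C (dom A) (cod A) (A2 A) (pr1 A) (pr2 A) \<and>
     cmp A \<in> hom C (A2 A) (A1 A) \<and>
     dom A \<cdot>\<^bsub>C\<^esub> idn A = Ident C (A0 A) \<and> cod A \<cdot>\<^bsub>C\<^esub> idn A = Ident C (A0 A) \<and>
     dom A \<cdot>\<^bsub>C\<^esub> cmp A = dom A \<cdot>\<^bsub>C\<^esub> pr2 A \<and> cod A \<cdot>\<^bsub>C\<^esub> cmp A = cod A \<cdot>\<^bsub>C\<^esub> pr1 A \<and>
     icomp C A (idn A \<cdot>\<^bsub>C\<^esub> cod A) (Ident C (A1 A)) = Ident C (A1 A) \<and>
     icomp C A (Ident C (A1 A)) (idn A \<cdot>\<^bsub>C\<^esub> dom A) = Ident C (A1 A) \<and>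
     (\<forall>A3 q1 q2. is_pullback C (pr2 A) (pr1 A) A3 q1 q2 \<longrightarrow>
        icomp C A (cmp A \<cdot>\<^bsub>C\<^esub> q1) (pr2 A \<cdot>\<^bsub>C\<^esub> q2) =
        icomp C A (pr1 A \<cdot>\<^bsub>C\<^esub> q1) (cmp A \<cdot>\<^bsub>C\<^esub> q2))"

definition discrete :: "('o, 'm) cat \<Rightarrow> 'o \<Rightarrow> ('o, 'm) icat" where
  "discrete C X =
     \<lparr>A0 = X, A1 = X, A2 = X, dom = Ident C X, cod = Ident C X, idn = Ident C X,
      pr1 = Ident C X, pr2 = Ident C X, cmp = Ident C X\<rparr>"

definition internal_poset :: "('o, 'm) cat \<Rightarrow> ('o, 'm) icat \<Rightarrow> bool" where
  "internal_poset C A \<longleftrightarrow> internal_category C A \<and>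
     (\<exists>P \<pi>1 \<pi>2 m. is_product C (A0 A) (A0 A) P \<pi>1 \<pi>2 \<and>
        m \<in> hom C (A1 A) P \<and> \<pi>1 \<cdot>\<^bsub>C\<^esub> m = dom A \<and> \<pi>2 \<cdot>\<^bsub>C\<^esub> m = cod A \<and> monomorphism C m)"


record 'm ifunctor =
  on0 :: 'm
  on1 :: 'm

definition internal_functor ::
  "('o, 'm) cat \<Rightarrow> ('o, 'm) icat \<Rightarrow> ('o, 'm) icat \<Rightarrow> 'm ifunctor \<Rightarrow> bool" where
  "internal_functor C A B F \<longleftrightarrow>
     on0 F \<in> hom C (A0 A) (A0 B) \<and> on1 F \<in> hom C (A1 A) (A1 B) \<and>
     dom B \<cdot>\<^bsub>C\<^esub> on1 F = on0 F \<cdot>\<^bsub>C\<^esub> dom A \<and>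
     cod B \<cdot>\<^bsub>C\<^esub> on1 F = on0 F \<cdot>\<^bsub>C\<^esub> cod A \<and>
     on1 F \<cdot>\<^bsub>C\<^esub> idn A = idn B \<cdot>\<^bsub>C\<^esub> on0 F \<and>
     on1 F \<cdot>\<^bsub>C\<^esub> cmp A = icomp C B (on1 F \<cdot>\<^bsub>C\<^esub> pr1 A) (on1 F \<cdot>\<^bsub>C\<^esub> pr2 A)"

definition ifunctor_comp ::
  "('o, 'm) cat \<Rightarrow> 'm ifunctor \<Rightarrow> 'm ifunctor \<Rightarrow> 'm ifunctor" where
  "ifunctor_comp C G F = \<lparr>on0 = on0 G \<cdot>\<^bsub>C\<^esub> on0 F, on1 = on1 G \<cdot>\<^bsub>C\<^esub> on1 F\<rparr>"

definition internal_nat_trans ::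
  "('o, 'm) cat \<Rightarrow> ('o, 'm) icat \<Rightarrow> ('o, 'm) icat \<Rightarrow> 'm ifunctor \<Rightarrow> 'm ifunctor \<Rightarrow> 'm set" where
  "internal_nat_trans C A B F G =
     {\<alpha> \<in> hom C (A0 A) (A1 B).
        dom B \<cdot>\<^bsub>C\<^esub> \<alpha> = on0 F \<and> cod B \<cdot>\<^bsub>C\<^esub> \<alpha> = on0 G \<and>
        icomp C B (on1 G) (\<alpha> \<cdot>\<^bsub>C\<^esub> dom A) = icomp C B (\<alpha> \<cdot>\<^bsub>C\<^esub> cod A) (on1 F)}"

text \<open>
  In the 2-category of internal categories, the vertical composite of \<open>\<alpha> : F \<Rightarrow> G\<close> and
  \<open>\<beta> : G \<Rightarrow> H\<close>, with \<open>F, G, H : A \<rightarrow> B\<close>, is \<open>icomp C B \<beta> \<alpha>\<close>, and the whiskering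
  of \<open>\<alpha>\<close> with \<open>S : A' \<rightarrow> A\<close> is \<open>\<alpha> \<cdot>\<^bsub>C\<^esub> on0 S\<close>.
\<close>

definition right_kan_extension ::
  "('o, 'm) cat \<Rightarrow> ('o, 'm) icat \<Rightarrow> ('o, 'm) icat \<Rightarrow> ('o, 'm) icat \<Rightarrow>
   'm ifunctor \<Rightarrow> 'm ifunctor \<Rightarrow> 'm ifunctor \<Rightarrow> bool" where
  "right_kan_extension C Z Y A S T R \<longleftrightarrow>
     internal_functor C Z Y S \<and> internal_functor C Z A T \<and> internal_functor C Y A R \<and>
     (\<exists>\<phi> :: 'm ifunctor \<Rightarrow> 'm \<Rightarrow> 'm.
        (\<forall>H. internal_functor C Y A H \<longrightarrow>
           bij_betw (\<phi> H) (internal_nat_trans C Y A H R) (internal_nat_trans C Z A (ifunctor_comp C H S) T)) \<and>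
        (\<forall>H H' \<beta> \<alpha>. internal_functor C Y A H \<and> internal_functor C Y A H' \<and>
             \<beta> \<in> internal_nat_trans C Y A H' H \<and> \<alpha> \<in> internal_nat_trans C Y A H R \<longrightarrow>
           \<phi> H' (icomp C A \<alpha> \<beta>) = icomp C A (\<phi> H \<alpha>) (\<beta> \<cdot>\<^bsub>C\<^esub> on0 S)))"

text \<open>
  The tensor of a set \<open>I\<close> with \<open>X\<close> is the discrete internal category on a copower of \<open>X\<close>
  by \<open>I\<close>, and a function acts through the induced arrow of copowers.  Copowers being unique
  only up to isomorphism, all choices of them are considered.
\<close>

definition has_simple_ad_hoc_polymorphism ::
  "'i rel \<Rightarrow> ('o, 'm) cat \<Rightarrow> ('o, 'm) icat \<Rightarrow> bool" where
  "has_simple_ad_hoc_polymorphism \<kappa> C A \<longleftrightarrow>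
     (\<forall>X \<in> Obj C. \<forall>(I :: 'i set) (I' :: 'i set). small \<kappa> I \<and> small \<kappa> I' \<longrightarrow>
       (\<forall>P \<iota> Q \<iota>' p T.
          is_copower C (I \<times> I') X P \<iota> \<and> is_copower C I X Q \<iota>' \<and>
          is_copower_map C (I \<times> I') fst P \<iota> Q \<iota>' p \<and>
          internal_functor C (discrete C P) A T \<longrightarrow>
          (\<exists>R. right_kan_extension C (discrete C P) (discrete C Q) A
                 \<lparr>on0 = p, on1 = p\<rparr> T R)))"

end

theory Submission
  imports Defs
begin

text \<open>
  This is Freyd's argument.  Let \<open>f \<noteq> g : W \<rightarrow> A1\<close> have the same domain \<open>a\<close> and codomain \<open>b\<close>, and
  let \<open>\<lambda>\<close> be a set equipotent to \<open>hom(W, A1)\<close>.  Extend the functor \<open>\<lambda> \<otimes> W \<rightarrow> A\<close> that is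
  constantly \<open>b\<close> along the codiagonal \<open>\<lambda> \<otimes> W \<rightarrow> W\<close>.  Transformations from \<open>a\<close> to the extension are
  elements of \<open>hom(W, A1)\<close> and correspond to \<open>\<lambda>\<close>-indexed families of arrows \<open>a \<rightarrow> b\<close>, of which
  \<open>f\<close> and \<open>g\<close> alone yield \<open>2\<^sup>\<lambda>\<close>, contradicting Cantor's theorem.
\<close>

section \<open>Binary products and copowers in the ambient category\<close>

lemma hom_Dom: "f \<in> hom C X Y \<Longrightarrow> Dom C f = X"
  and hom_Arr: "f \<in> hom C X Y \<Longrightarrow> f \<in> Arr C"
  by (auto simp: hom_def)

lemma binary_product_exists:
  assumes "category C" "finitely_complete C" "X \<in> Obj C" "Y \<in> Obj C"
  shows "\<exists>P \<pi>1 \<pi>2. is_product C X Y P \<pi>1 \<pi>2"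
proof -
  interpret category C by fact
  \<comment> \<open>The discrete category on \<open>0\<close> and \<open>1\<close>, each arrow being
    the identity of the object with the same number; a cone over it is just a pair of
    arrows.\<close>
  define J :: "(nat, nat) cat" where
    "J = \<lparr>Obj = {0, 1}, Arr = {0, 1}, Dom = id, Cod = id, Ident = id, Comp = (\<lambda>v u. u)\<rparr>"
  define D0 where "D0 = (\<lambda>j::nat. if j = 0 then X else Y)"
  define D1 where "D1 = (\<lambda>j. Ident C (D0 j))"
  have "category J"
    by unfold_locales (auto simp: J_def hom_def)
  moreover have "is_functor J C D0 D1"
    using assms(3,4) Ident_hom Ident_left[OF Ident_hom]
    by (auto simp: is_functor_def J_def D0_def D1_def)
  moreover have "finite (Obj J)" "finite (Arr J)"
    by (auto simp: J_def)
  ultimately obtain L \<pi> where L: "is_limit J C D0 D1 L \<pi>"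
    using assms(2) unfolding finitely_complete_def by blast
  have cone_iff: "is_cone J C D0 D1 W \<rho> \<longleftrightarrow> W \<in> Obj C \<and> \<rho> 0 \<in> hom C W X \<and> \<rho> 1 \<in> hom C W Y"
    for W \<rho>
    by (auto simp: is_cone_def J_def D0_def D1_def Ident_left)
  have cone: "is_cone J C D0 D1 L \<pi>"
    and univ: "\<And>W \<rho>. is_cone J C D0 D1 W \<rho> \<Longrightarrow>
      \<exists>!u. u \<in> hom C W L \<and> (\<forall>j \<in> Obj J. \<pi> j \<cdot>\<^bsub>C\<^esub> u = \<rho> j)"
    using L by (auto simp: is_limit_def)
  have "\<exists>!u. u \<in> hom C W L \<and> \<pi> 0 \<cdot>\<^bsub>C\<^esub> u = f \<and> \<pi> 1 \<cdot>\<^bsub>C\<^esub> u = g"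
    if "W \<in> Obj C" "f \<in> hom C W X" "g \<in> hom C W Y" for W f g
    using univ[of W "\<lambda>j. if j = 0 then f else g"] that unfolding cone_iff
    by (simp add: J_def)
  then have "is_product C X Y L (\<pi> 0) (\<pi> 1)"
    using cone unfolding cone_iff is_product_def by blast
  then show ?thesis by blast
qed

text \<open>Lets \<open>X\<close> itself serve as the tensor of a one-element set with
  \<open>X\<close>, so that a Kan extension along the codiagonal is defined on
  \<open>X\<close>.\<close>

lemma is_copower_singleton:
  assumes "category C" "X \<in> Obj C"
  shows "is_copower C {i} X X (\<lambda>_. Ident C X)"
proof -
  interpret category C by fact
  show ?thesis
    using assms(2) Ident_hom by (auto simp: is_copower_def Ident_right)
qed

text \<open>Polymorphism speaks of copowers over index sets \<open>I \<times> I'\<close>; reindexing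
  along a bijection brings a copower over \<open>I\<close> into that form.\<close>

lemma is_copower_reindex:
  assumes "is_copower C I X P \<iota>" "bij_betw s K I"
  shows "is_copower C K X P (\<iota> \<circ> s)"
  unfolding is_copower_def
proof (intro conjI ballI allI impI)
  show "X \<in> Obj C" "P \<in> Obj C"
    using assms(1) by (auto simp: is_copower_def)
  show "(\<iota> \<circ> s) k \<in> hom C X P" if "k \<in> K" for k
    using assms that by (auto simp: is_copower_def bij_betw_def)
  fix W f assume W: "W \<in> Obj C" and f: "\<forall>k \<in> K. f k \<in> hom C X W"
  have inv: "inv_into K s i \<in> K" "s (inv_into K s i) = i" if "i \<in> I" for i
    using assms(2) that by (auto simp: bij_betw_def inv_into_into f_inv_into_f)
  have "(\<forall>i \<in> I. u \<cdot>\<^bsub>C\<^esub> \<iota> i = f (inv_into K s i)) \<longleftrightarrow> (\<forall>k \<in> K. u \<cdot>\<^bsub>C\<^esub> (\<iota> \<circ> s) k = f k)" for u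
    using assms(2) by (auto simp: bij_betw_def)
  moreover have "\<exists>!u. u \<in> hom C P W \<and> (\<forall>i \<in> I. u \<cdot>\<^bsub>C\<^esub> \<iota> i = f (inv_into K s i))"
    using assms(1) W f inv(1) by (simp add: is_copower_def)
  ultimately show "\<exists>!u. u \<in> hom C P W \<and> (\<forall>k \<in> K. u \<cdot>\<^bsub>C\<^esub> (\<iota> \<circ> s) k = f k)"
    by simp
qed

section \<open>Calculus of generalized elements of an internal category\<close>

locale internal_cat = category C for C :: "('o, 'm) cat" (structure) +
  fixes A :: "('o, 'm) icat"
  assumes internal: "internal_category C A"
begin

lemma dom_hom: "dom A \<in> hom C (A1 A) (A0 A)"
  and cod_hom: "cod A \<in> hom C (A1 A) (A0 A)"
  and idn_hom: "idn A \<in> hom C (A0 A) (A1 A)"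
  and cmp_hom: "cmp A \<in> hom C (A2 A) (A1 A)"
  and pr1_hom: "pr1 A \<in> hom C (A2 A) (A1 A)"
  and pr2_hom: "pr2 A \<in> hom C (A2 A) (A1 A)"
  and A1_Obj: "A1 A \<in> Obj C"
  and A0_Obj: "A0 A \<in> Obj C"
  using internal by (auto simp: internal_category_def is_pullback_def hom_def)

lemma dom_idn: "x \<in> hom C W (A0 A) \<Longrightarrow> dom A \<cdot> (idn A \<cdot> x) = x"
  and cod_idn: "x \<in> hom C W (A0 A) \<Longrightarrow> cod A \<cdot> (idn A \<cdot> x) = x"
  using internal
  by (simp_all add: Comp_assoc[OF _ idn_hom dom_hom] Comp_assoc[OF _ idn_hom cod_hom]
      Ident_left internal_category_def)

text \<open>Justifies the definite description in \<open>ipair\<close>: composable pairs factor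
  uniquely through the pullback \<open>A2 A\<close>.\<close>

lemma ipair_unique:
  assumes "g \<in> hom C W (A1 A)" "f \<in> hom C W (A1 A)" "dom A \<cdot> g = cod A \<cdot> f"
  shows "\<exists>!u. u \<in> hom C (Dom C g) (A2 A) \<and> pr1 A \<cdot> u = g \<and> pr2 A \<cdot> u = f"
proof -
  have "W \<in> Obj C" using assms(1) Dom_Obj by (auto simp: hom_def)
  moreover have "is_pullback C (dom A) (cod A) (A2 A) (pr1 A) (pr2 A)"
    using internal by (simp add: internal_category_def)
  ultimately show ?thesis
    using assms by (simp add: is_pullback_def hom_Dom[OF dom_hom] hom_Dom[OF cod_hom] hom_Dom[OF assms(1)])
qed

lemma ipair_hom:
  assumes "g \<in> hom C W (A1 A)" "f \<in> hom C W (A1 A)" "dom A \<cdot> g = cod A \<cdot> f"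
  shows "ipair C A g f \<in> hom C W (A2 A)" "pr1 A \<cdot> ipair C A g f = g" "pr2 A \<cdot> ipair C A g f = f"
  using theI'[OF ipair_unique[OF assms]] unfolding ipair_def by (auto simp: hom_Dom[OF assms(1)])

lemma ipair_eqI:
  assumes "u \<in> hom C W (A2 A)" "pr1 A \<cdot> u = g" "pr2 A \<cdot> u = f"
  shows "ipair C A g f = u"
proof -
  have g: "g \<in> hom C W (A1 A)" and f: "f \<in> hom C W (A1 A)"
    using assms Comp_hom[OF assms(1)] pr1_hom pr2_hom by auto
  have "dom A \<cdot> pr1 A = cod A \<cdot> pr2 A"
    using internal by (simp add: internal_category_def is_pullback_def)
  then have "dom A \<cdot> g = cod A \<cdot> f"
    using assms(2,3) Comp_assoc[OF assms(1) pr1_hom dom_hom]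
      Comp_assoc[OF assms(1) pr2_hom cod_hom] by metis
  from the1_equality[OF ipair_unique[OF g f this]] assms show ?thesis
    unfolding ipair_def by (simp add: hom_Dom[OF g])
qed

text \<open>Pairings are unique, hence stable under change of stage. Laws stated for the generic
  arrow \<open>Ident C (A1 A)\<close> thus pass to all generalized elements
  \<open>x\<close>.\<close>

lemma icomp_precomp:
  assumes "g \<in> hom C V (A1 A)" "f \<in> hom C V (A1 A)" "dom A \<cdot> g = cod A \<cdot> f" "x \<in> hom C W V"
  shows "icomp C A g f \<cdot> x = icomp C A (g \<cdot> x) (f \<cdot> x)"
proof -
  note p = ipair_hom[OF assms(1-3)]
  have "ipair C A (g \<cdot> x) (f \<cdot> x) = ipair C A g f \<cdot> x"
    by (rule ipair_eqI[OF Comp_hom[OF assms(4) p(1)]])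
      (simp_all add: Comp_assoc[OF assms(4) p(1) pr1_hom] Comp_assoc[OF assms(4) p(1) pr2_hom] p)
  then show ?thesis
    unfolding icomp_def by (simp add: Comp_assoc[OF assms(4) p(1) cmp_hom])
qed

lemma icomp_left_unit:
  assumes x: "x \<in> hom C W (A1 A)"
  shows "icomp C A (idn A \<cdot> (cod A \<cdot> x)) x = x"
proof -
  have "icomp C A (idn A \<cdot> cod A) (Ident C (A1 A)) \<cdot> x
      = icomp C A ((idn A \<cdot> cod A) \<cdot> x) (Ident C (A1 A) \<cdot> x)"
    by (rule icomp_precomp[OF _ _ _ x])
      (simp_all add: Comp_hom[OF cod_hom idn_hom] Ident_hom A1_Obj dom_idn[OF cod_hom]
        Ident_right[OF cod_hom])
  then show ?thesis
    using internal x
    by (simp add: internal_category_def Ident_left Comp_assoc[OF x cod_hom idn_hom])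
qed

lemma icomp_right_unit:
  assumes x: "x \<in> hom C W (A1 A)"
  shows "icomp C A x (idn A \<cdot> (dom A \<cdot> x)) = x"
proof -
  have "icomp C A (Ident C (A1 A)) (idn A \<cdot> dom A) \<cdot> x
      = icomp C A (Ident C (A1 A) \<cdot> x) ((idn A \<cdot> dom A) \<cdot> x)"
    by (rule icomp_precomp[OF _ _ _ x])
      (simp_all add: Comp_hom[OF dom_hom idn_hom] Ident_hom A1_Obj cod_idn[OF dom_hom]
        Ident_right[OF dom_hom])
  then show ?thesis
    using internal x
    by (simp add: internal_category_def Ident_left Comp_assoc[OF x dom_hom idn_hom])
qed

text \<open>On a discrete category the arrow part must pick the identities of the object part;
  preservation of composition is then the unit law at an identity.\<close>

lemma discrete_functor:
  assumes x: "x \<in> hom C W (A0 A)"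
  shows "internal_functor C (discrete C W) A \<lparr>on0 = x, on1 = idn A \<cdot> x\<rparr>"
proof -
  have ix: "idn A \<cdot> x \<in> hom C W (A1 A)" by (rule Comp_hom[OF x idn_hom])
  then have "icomp C A (idn A \<cdot> x) (idn A \<cdot> x) = idn A \<cdot> x"
    using icomp_left_unit[OF ix] cod_idn[OF x] by simp
  then show ?thesis
    using x ix by (simp add: internal_functor_def discrete_def dom_idn cod_idn Ident_right)
qed

text \<open>Over a discrete domain both functors act by identities, so the two sides of the
  naturality square reduce to \<open>\<alpha>\<close> by the unit laws.\<close>

lemma discrete_nat_transI:
  assumes \<alpha>: "\<alpha> \<in> hom C W (A1 A)"
    and "on0 F = dom A \<cdot> \<alpha>" "on1 F = idn A \<cdot> (dom A \<cdot> \<alpha>)"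
    and "on0 G = cod A \<cdot> \<alpha>" "on1 G = idn A \<cdot> (cod A \<cdot> \<alpha>)"
  shows "\<alpha> \<in> internal_nat_trans C (discrete C W) A F G"
  using assms
  by (simp add: internal_nat_trans_def discrete_def icomp_left_unit icomp_right_unit Ident_right)

section \<open>Counting transformations into the Kan extension\<close>

lemma polymorphism_hom_card:
  fixes I :: "'i set"
  assumes \<kappa>: "infinite (Field (\<kappa> :: 'i rel))" "Card_order \<kappa>"
    and poly: "has_simple_ad_hoc_polymorphism \<kappa> C A"
    and tensors: "has_tensors \<kappa> C"
    and small: "small \<kappa> I"
    and f: "f \<in> hom C W (A1 A)" and g: "g \<in> hom C W (A1 A)" and "f \<noteq> g"
    and dom_eq: "dom A \<cdot> f = dom A \<cdot> g" and cod_eq: "cod A \<cdot> f = cod A \<cdot> g"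
  shows "\<exists>e. inj_on e (Pow I) \<and> e ` Pow I \<subseteq> hom C W (A1 A)"
proof -
  define a b where "a = dom A \<cdot> f" and "b = cod A \<cdot> f"
  have a: "a \<in> hom C W (A0 A)" and b: "b \<in> hom C W (A0 A)"
    unfolding a_def b_def by (rule Comp_hom[OF f dom_hom] Comp_hom[OF f cod_hom])+
  have W: "W \<in> Obj C" using f Dom_Obj by (auto simp: hom_def)
  obtain P \<iota> where P: "is_copower C I W P \<iota>"
    using tensors small W unfolding has_tensors_def by blast
  have copair: "\<exists>!u. u \<in> hom C P V \<and> (\<forall>k \<in> I. u \<cdot> \<iota> k = h k)"
    if "V \<in> Obj C" "\<forall>k \<in> I. h k \<in> hom C W V" for V h
    using P that by (simp add: is_copower_def)
  have \<iota>: "\<iota> k \<in> hom C W P" if "k \<in> I" for k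
    using P that by (simp add: is_copower_def)
  \<comment> \<open>The codiagonal of the copower.\<close>
  obtain p where p: "p \<in> hom C P W" and p\<iota>: "\<And>k. k \<in> I \<Longrightarrow> p \<cdot> \<iota> k = Ident C W"
    using copair[of W "\<lambda>_. Ident C W"] W Ident_hom by blast
  define F T where "F = \<lparr>on0 = a, on1 = idn A \<cdot> a\<rparr>"
    and "T = \<lparr>on0 = b \<cdot> p, on1 = idn A \<cdot> (b \<cdot> p)\<rparr>"
  \<comment> \<open>An arbitrary element: with \<open>{i}\<close> as the first index set, the
    projection from \<open>{i} \<times> I\<close> induces the codiagonal \<open>p\<close>.\<close>
  define i :: 'i where "i = undefined"
  have "is_copower C ({i} \<times> I) W P (\<iota> \<circ> snd)"
    by (rule is_copower_reindex[OF P]) (auto simp: bij_betw_def inj_on_def)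
  moreover have "is_copower C {i} W W (\<lambda>_. Ident C W)"
    by (rule is_copower_singleton[OF category_axioms W])
  moreover have "is_copower_map C ({i} \<times> I) fst P (\<iota> \<circ> snd) W (\<lambda>_. Ident C W) p"
    using p p\<iota> by (auto simp: is_copower_map_def)
  moreover have "internal_functor C (discrete C P) A T"
    unfolding T_def by (rule discrete_functor[OF Comp_hom[OF p b]])
  moreover have "small \<kappa> {i}"
    unfolding small_def
    using finite_ordLess_infinite[OF card_of_Well_order, of \<kappa> "{i}"] \<kappa>
    by (simp add: card_order_on_def Field_card_of)
  ultimately obtain R where
    "right_kan_extension C (discrete C P) (discrete C W) A \<lparr>on0 = p, on1 = p\<rparr> T R"
    using poly W small unfolding has_simple_ad_hoc_polymorphism_def by blast
  moreover have "internal_functor C (discrete C W) A F"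
    unfolding F_def by (rule discrete_functor[OF a])
  ultimately obtain \<phi> where
    "bij_betw \<phi> (internal_nat_trans C (discrete C W) A F R)
       (internal_nat_trans C (discrete C P) A (ifunctor_comp C F \<lparr>on0 = p, on1 = p\<rparr>) T)"
      (is "bij_betw \<phi> ?M ?N")
    unfolding right_kan_extension_def by blast
  then have "bij_betw (inv_into ?M \<phi>) ?N ?M"
    by (rule bij_betw_inv_into)
  then have inv: "inj_on (inv_into ?M \<phi>) ?N" "inv_into ?M \<phi> ` ?N = ?M"
    by (simp_all add: bij_betw_def)
  \<comment> \<open>A subset \<open>S\<close> is coded by the arrow that is \<open>f\<close> on the
    components in \<open>S\<close> and \<open>g\<close> on all others.\<close>
  define c where "c S = (THE u. u \<in> hom C P (A1 A) \<and> (\<forall>k \<in> I. u \<cdot> \<iota> k = (if k \<in> S then f else g)))"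
    for S
  have "\<exists>!u. u \<in> hom C P (A1 A) \<and> (\<forall>k \<in> I. u \<cdot> \<iota> k = (if k \<in> S then f else g))" for S
    using copair[OF A1_Obj] f g by simp
  from theI'[OF this] have c: "c S \<in> hom C P (A1 A)"
    and c\<iota>: "k \<in> I \<Longrightarrow> c S \<cdot> \<iota> k = (if k \<in> S then f else g)" for S k
    unfolding c_def by blast+
  \<comment> \<open>The injections of a copower are jointly epic, so equations out of
    \<open>P\<close> may be checked on components.\<close>
  have eqI: "u = v" if "u \<in> hom C P V" "v \<in> hom C P V" "\<And>k. k \<in> I \<Longrightarrow> u \<cdot> \<iota> k = v \<cdot> \<iota> k" for u v V
  proof -
    have "V \<in> Obj C" using that(1) Cod_Obj by (auto simp: hom_def)
    moreover have "\<forall>k\<in>I. v \<cdot> \<iota> k \<in> hom C W V"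
      using Comp_hom[OF \<iota> that(2)] by blast
    ultimately show ?thesis using copair[of V "\<lambda>k. v \<cdot> \<iota> k"] that by blast
  qed
  have collapse: "(y \<cdot> p) \<cdot> \<iota> k = y" if "y \<in> hom C W V" "k \<in> I" for y V k
    using Comp_assoc[OF \<iota>[OF that(2)] p that(1)] p\<iota>[OF that(2)] Ident_right[OF that(1)] by simp
  \<comment> \<open>The choice between \<open>f\<close> and \<open>g\<close> is invisible to
    \<open>dom A\<close> and \<open>cod A\<close>, so all \<open>c S\<close> are parallel.\<close>
  have dom_c: "dom A \<cdot> c S = a \<cdot> p" for S
  proof (rule eqI[OF Comp_hom[OF c dom_hom] Comp_hom[OF p a]])
    show "(dom A \<cdot> c S) \<cdot> \<iota> k = (a \<cdot> p) \<cdot> \<iota> k" if "k \<in> I" for k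
      using Comp_assoc[OF \<iota>[OF that] c dom_hom, of S] c\<iota>[OF that, of S] collapse[OF a that] dom_eq
      by (auto simp: a_def split: if_splits)
  qed
  have cod_c: "cod A \<cdot> c S = b \<cdot> p" for S
  proof (rule eqI[OF Comp_hom[OF c cod_hom] Comp_hom[OF p b]])
    show "(cod A \<cdot> c S) \<cdot> \<iota> k = (b \<cdot> p) \<cdot> \<iota> k" if "k \<in> I" for k
      using Comp_assoc[OF \<iota>[OF that] c cod_hom, of S] c\<iota>[OF that, of S] collapse[OF b that] cod_eq
      by (auto simp: b_def split: if_splits)
  qed
  have cN: "c S \<in> ?N" for S
    by (rule discrete_nat_transI[OF c])
      (simp_all add: ifunctor_comp_def F_def T_def dom_c cod_c Comp_assoc[OF p a idn_hom])
  \<comment> \<open>Since \<open>f\<close> and \<open>g\<close> differ, \<open>k\<close> in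
    \<open>I\<close> lies in \<open>S\<close> exactly when component \<open>k\<close> of
    \<open>c S\<close> is \<open>f\<close>.\<close>
  have "S \<subseteq> S'" if "S \<subseteq> I" "c S = c S'" for S S'
    using c\<iota> that \<open>f \<noteq> g\<close> by (metis subset_iff)
  then have "inj_on c (Pow I)"
    by (intro inj_onI subset_antisym) simp_all
  moreover have "inj_on (inv_into ?M \<phi>) (c ` Pow I)"
    using cN by (intro inj_on_subset[OF inv(1)]) blast
  ultimately have "inj_on (inv_into ?M \<phi> \<circ> c) (Pow I)"
    by (rule comp_inj_on)
  \<comment> \<open>Transposing along the inverse of \<open>\<phi>\<close> turns each family
    \<open>c S\<close> into a single arrow out of \<open>W\<close>.\<close>
  moreover have "?M \<subseteq> hom C W (A1 A)"
    by (auto simp: internal_nat_trans_def discrete_def)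
  then have "(inv_into ?M \<phi> \<circ> c) ` Pow I \<subseteq> hom C W (A1 A)"
    using inv(2) cN by fastforce
  ultimately show ?thesis by blast
qed

end

section \<open>The diagonal contradiction\<close>

theorem corollary2:
  fixes \<kappa> :: "'i rel" and C :: "('o, 'm) cat" and A :: "('o, 'm) icat"
  assumes "universe_cardinal \<kappa>"
    and "category C"
    and "finitely_complete C"
    and "locally_small \<kappa> C"
    and "has_tensors \<kappa> C"
    and "internal_category C A"
    and "has_simple_ad_hoc_polymorphism \<kappa> C A"
  shows "internal_poset C A"
proof -
  interpret internal_cat C A
    using assms(2,6) by (simp add: internal_cat_def internal_cat_axioms_def)
  have \<kappa>: "Card_order \<kappa>" "infinite (Field \<kappa>)"
    using assms(1) by (auto simp: universe_cardinal_def)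
  obtain P \<pi>1 \<pi>2 where P: "is_product C (A0 A) (A0 A) P \<pi>1 \<pi>2"
    using binary_product_exists[OF assms(2,3) A0_Obj A0_Obj] by blast
  then have \<pi>1: "\<pi>1 \<in> hom C P (A0 A)" and \<pi>2: "\<pi>2 \<in> hom C P (A0 A)"
    by (auto simp: is_product_def)
  \<comment> \<open>The pairing of \<open>dom A\<close> and \<open>cod A\<close>, to be shown
    monic.\<close>
  obtain m where m: "m \<in> hom C (A1 A) P" "\<pi>1 \<cdot>\<^bsub>C\<^esub> m = dom A" "\<pi>2 \<cdot>\<^bsub>C\<^esub> m = cod A"
    using P A1_Obj dom_hom cod_hom unfolding is_product_def by blast
  have "f = g"
    if W: "W \<in> Obj C" and f: "f \<in> hom C W (A1 A)" and g: "g \<in> hom C W (A1 A)"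
      and eq: "m \<cdot>\<^bsub>C\<^esub> f = m \<cdot>\<^bsub>C\<^esub> g" for W f g
  proof (rule ccontr)
    assume "f \<noteq> g"
    have small_hom: "|hom C W (A1 A)| <o \<kappa>"
      using assms(4) W A1_Obj by (simp add: locally_small_def small_def)
    then have "|hom C W (A1 A)| \<le>o |Field \<kappa>|"
      using card_of_Field_ordIso[OF \<kappa>(1)] ordLess_imp_ordLeq ordIso_symmetric ordLeq_ordIso_trans
      by blast
    \<comment> \<open>Index sets must consist of elements of \<open>'i\<close>, so the hom-set is
      copied into \<open>Field \<kappa>\<close>; its image \<open>I\<close> is small because
      \<open>C\<close> is locally small.\<close>
    then obtain e where e: "inj_on e (hom C W (A1 A))" "e ` hom C W (A1 A) \<subseteq> Field \<kappa>"
      using card_of_ordLeq[of "hom C W (A1 A)" "Field \<kappa>"] by blast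
    define I where "I = e ` hom C W (A1 A)"
    have "small \<kappa> I"
      unfolding small_def I_def using card_of_image small_hom ordLeq_ordLess_trans by blast
    moreover have "dom A \<cdot>\<^bsub>C\<^esub> f = dom A \<cdot>\<^bsub>C\<^esub> g" "cod A \<cdot>\<^bsub>C\<^esub> f = cod A \<cdot>\<^bsub>C\<^esub> g"
      using Comp_assoc[OF f m(1) \<pi>1] Comp_assoc[OF g m(1) \<pi>1]
        Comp_assoc[OF f m(1) \<pi>2] Comp_assoc[OF g m(1) \<pi>2] eq m(2,3) by metis+
    ultimately obtain d where "inj_on d (Pow I)" "d ` Pow I \<subseteq> hom C W (A1 A)"
      using polymorphism_hom_card[OF \<kappa>(2,1) assms(7,5) _ f g \<open>f \<noteq> g\<close>] by blast
    \<comment> \<open>Composing with \<open>e\<close> brings the codes back into \<open>I\<close>: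
      an injection of \<open>Pow I\<close> into \<open>I\<close>, against Cantor.\<close>
    then have "inj_on (e \<circ> d) (Pow I)" "(e \<circ> d) ` Pow I \<subseteq> I"
      using comp_inj_on[of d "Pow I" e] inj_on_subset[OF e(1)] by (auto simp: I_def)
    then have "|Pow I| \<le>o |I|"
      using card_of_ordLeq[of "Pow I" I] by blast
    then show False
      using card_of_Pow[of I] not_ordLess_ordLeq by blast
  qed
  then have "monomorphism C m"
    using m(1) by (simp add: monomorphism_def hom_Arr hom_Dom)
  then show ?thesis
    using assms(6) P m unfolding internal_poset_def by blast
qed

end
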